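(* Let $d\geq 2$ be an integer, $n$ a positive integer, $x$ an indeterminate, and $s\in\{-1,1\}$ with $n\equiv s\pmod{2d}$. Then $$\sum_{k=0}^{n-1}\frac{(x;q^d)_k\,(q^s;q^d)_k}{(q^d;q^d)_k}\,q^{dk}\equiv \sum_{k=0}^{n-1}\frac{(x^2;q^{2d})_k\,(q^s;q^{2d})_k}{(q^{2d};q^{2d})_k}\,q^{2dk} \pmod{\Phi_n(q)}.$$
   Context: The $q$-shifted factorial is $(a;q)_0=1$ and $(a;q)_k=(1-a)(1-aq)\cdots(1-aq^{k-1})$ for $k\geq 1$. $\Phi_n(q)$ denotes the $n$th cyclotomic polynomial. A congruence $A\equiv B \pmod{P(q)}$ between rational functions in $q$ (with coefficients that may involve other indeterminates such as $x$) means that $A-B$ can be written as a quotient whose numerator is divisible by $P(q)$ and whose denominator is coprime to $P(q)$. *)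

theory Defs
  imports
    Complex_Main
    "HOL-Computational_Algebra.Computational_Algebra"
    "HOL-Number_Theory.Cong"
begin

definition qpoch :: "'a::comm_ring_1 \<Rightarrow> 'a \<Rightarrow> nat \<Rightarrow> 'a" where
  "qpoch a q k = (\<Prod>j<k. 1 - a * q ^ j)"

definition complex_cyclotomic :: "nat \<Rightarrow> complex poly" where
  "complex_cyclotomic n =
     (\<Prod>k\<in>{k \<in> {1..n}. coprime k n}. [:- cis (2 * pi * real k / real n), 1:])"

text \<open>The description is proper: see \<open>of_int_cyclotomic\<close> below.\<close>

definition cyclotomic :: "nat \<Rightarrow> int poly" where
  "cyclotomic n = (THE p. map_poly of_int p = complex_cyclotomic n)"

lemma prod_complex_cyclotomic:
  assumes "n > 0"
  shows "(\<Prod>d\<in>{d. d dvd n}. complex_cyclotomic d) = monom 1 n - 1"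
proof -
  define F where "F = (\<lambda>t::real. [:- cis (2 * pi * t), 1:])"
  have "(\<Prod>d\<in>{d. d dvd n}. complex_cyclotomic d) =
        (\<Prod>d\<in>{d. d dvd n}. \<Prod>k\<in>{k \<in> {1..d}. coprime k d}. F (real k / real d))"
    by (simp add: complex_cyclotomic_def F_def)
  also have "\<dots> = (\<Prod>(d,k)\<in>(SIGMA d:{d. d dvd n}. {k \<in> {1..d}. coprime k d}). F (real k / real d))"
    using assms by (subst prod.Sigma) auto
  also have "\<dots> = (\<Prod>k\<in>{1..n}. F (real k / real n))"
  proof (rule prod.reindex_bij_witness[where
          i = "\<lambda>k. (n div gcd k n, k div gcd k n)" and j = "\<lambda>(d,k). k * (n div d)"], goal_cases)
    case (1 a)
    then obtain d k where a: "a = (d,k)" "d dvd n" "1 \<le> k" "k \<le> d" "coprime k d" by auto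
    from a(2) obtain m where m: "n = d * m" by (elim dvdE)
    have "d > 0" "m > 0" using m assms by auto
    have "gcd (k * m) (d * m) = m"
      using a(5) by (metis coprime_imp_gcd_eq_1 gcd_mult_distrib_nat mult.commute mult.right_neutral)
    then show ?case using a m \<open>d > 0\<close> \<open>m > 0\<close> by simp
  next
    case (2 a)
    then obtain d k where a: "a = (d,k)" "d dvd n" "1 \<le> k" "k \<le> d" "coprime k d" by auto
    from a(2) obtain m where m: "n = d * m" by (elim dvdE)
    have "d > 0" "m > 0" using m assms by auto
    then show ?case using a m by simp
  next
    case (3 k)
    define g where "g = gcd k n"
    have "g > 0" using assms by (simp add: g_def)
    obtain k' n' where kn: "k = k' * g" "n = n' * g"
      by (metis dvd_div_mult_self g_def gcd_dvd1 gcd_dvd2)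
    have "k div g = k'" "n div g = n'" "n' > 0" "n div n' = g"
      using kn \<open>g > 0\<close> assms by auto
    then show ?case unfolding prod.case g_def[symmetric] by (simp add: kn(1))
  next
    case (4 k)
    define g where "g = gcd k n"
    have "g > 0" using assms by (simp add: g_def)
    obtain k' n' where kn: "k = k' * g" "n = n' * g"
      by (metis dvd_div_mult_self g_def gcd_dvd1 gcd_dvd2)
    have "coprime (k div g) (n div g)"
      unfolding g_def using assms by (intro div_gcd_coprime) auto
    moreover have "k div g = k'" "n div g = n'" "n' dvd n" "1 \<le> k'" "k' \<le> n'"
      using kn \<open>g > 0\<close> 4 by auto
    ultimately show ?case unfolding g_def[symmetric] by simp
  next
    case (5 a)
    then obtain d k where a: "a = (d,k)" "d dvd n" "1 \<le> k" "k \<le> d" "coprime k d" by auto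
    from a(2) obtain m where m: "n = d * m" by (elim dvdE)
    have "d > 0" "m > 0" using m assms by auto
    then show ?case using a m by simp
  qed
  also have "\<dots> = (\<Prod>k<n. F (real k / real n))"
  proof -
    have "{1..n} = insert n {1..<n}" "{..<n} = insert 0 {1..<n}" using assms by auto
    then show ?thesis using assms by (simp add: F_def)
  qed
  also have "\<dots> = (\<Prod>z\<in>{z::complex. z ^ n = 1}. [:- z, 1:])"
    using prod.reindex_bij_betw[OF bij_betw_roots_unity[OF assms], of "\<lambda>z. [:- z, 1:]"]
    by (simp add: F_def)
  also have "\<dots> = monom 1 n - 1"
  proof (rule poly_eqI_degree_lead_coeff[where n = n and A = "{z::complex. z ^ n = 1}"])
    show "poly (\<Prod>z\<in>{z::complex. z ^ n = 1}. [:- z, 1:]) x = poly (monom 1 n - 1) x"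
      if "x \<in> {z. z ^ n = 1}" for x :: complex
      using that assms finite_roots_unity[of n, where 'a = complex]
      by (auto simp: poly_prod poly_monom)
    have 1: "degree (\<Prod>z\<in>{z::complex. z ^ n = 1}. [:- z, 1:]) = n"
      using assms by (subst degree_prod_eq_sum_degree) (auto simp: card_roots_unity_eq)
    have "lead_coeff (\<Prod>z\<in>{z::complex. z ^ n = 1}. [:- z, 1:]) = 1"
      by (simp add: lead_coeff_prod)
    then show "coeff (\<Prod>z\<in>{z::complex. z ^ n = 1}. [:- z, 1:]) n = coeff (monom 1 n - 1) n"
      using 1 assms by simp
    show "degree (\<Prod>z\<in>{z::complex. z ^ n = 1}. [:- z, 1:]) \<le> n" using 1 by simp
    show "degree (monom 1 n - 1 :: complex poly) \<le> n"
      by (simp add: degree_diff_le degree_monom_le)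
  qed (use assms card_roots_unity_eq in auto)
  finally show ?thesis .
qed

lemma lead_coeff_complex_cyclotomic: "lead_coeff (complex_cyclotomic n) = 1"
  by (simp add: complex_cyclotomic_def lead_coeff_prod)

lemma map_poly_of_int_mult:
  "map_poly (of_int :: int \<Rightarrow> complex) (p * q) = map_poly of_int p * map_poly of_int q"
  by (intro poly_eqI) (simp add: coeff_map_poly coeff_mult)

lemma map_poly_of_int_add:
  "map_poly (of_int :: int \<Rightarrow> complex) (p + q) = map_poly of_int p + map_poly of_int q"
  by (intro poly_eqI) (simp add: coeff_map_poly)

lemma map_poly_of_int_prod:
  "map_poly (of_int :: int \<Rightarrow> complex) (\<Prod>i\<in>A. f i) = (\<Prod>i\<in>A. map_poly of_int (f i))"
  by (induction A rule: infinite_finite_induct) (auto simp: map_poly_of_int_mult)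

lemma complex_cyclotomic_integral: "\<exists>p. map_poly of_int p = complex_cyclotomic n"
proof (induction n rule: less_induct)
  case (less n)
  show ?case
  proof (cases "n = 0")
    case True
    then show ?thesis by (intro exI[of _ 1]) (simp add: complex_cyclotomic_def)
  next
    case False
    define D where "D = {d. d dvd n \<and> d < n}"
    have D: "finite D" "{d. d dvd n} = insert n D" "n \<notin> D"
      using False by (auto simp: D_def dest: dvd_imp_le)
    obtain f where f: "\<And>d. d \<in> D \<Longrightarrow> map_poly of_int (f d) = complex_cyclotomic d"
      using less unfolding D_def mem_Collect_eq by metis
    define P where "P = (\<Prod>d\<in>D. f d)"
    let ?h = "map_poly (of_int :: int \<Rightarrow> complex)"
    have hP: "?h P = (\<Prod>d\<in>D. complex_cyclotomic d)"
      unfolding P_def map_poly_of_int_prod by (intro prod.cong) (auto simp: f)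
    have deg: "degree (?h p) = degree p" for p
      by (rule degree_map_poly) auto
    have "lead_coeff (?h P) = 1"
      unfolding hP by (simp add: lead_coeff_prod lead_coeff_complex_cyclotomic)
    then have lc: "lead_coeff P = 1"
      by (simp add: deg coeff_map_poly)
    then have P0: "P \<noteq> 0" by auto
    obtain u r where ur: "pseudo_divmod (monom 1 n - 1) P = (u, r)" by fastforce
    have eq: "monom 1 n - 1 = P * u + r" and r: "r = 0 \<or> degree r < degree P"
      using pseudo_divmod[OF P0 ur] lc by auto
    have "?h (monom 1 n - 1) = monom 1 n - 1"
      by (intro poly_eqI) (auto simp: coeff_map_poly)
    also have "\<dots> = complex_cyclotomic n * ?h P"
      using prod_complex_cyclotomic[of n] False D hP by simp
    finally have "complex_cyclotomic n * ?h P = ?h P * ?h u + ?h r"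
      by (simp add: eq map_poly_of_int_mult map_poly_of_int_add)
    then have *: "?h P * (complex_cyclotomic n - ?h u) = ?h r"
      by (simp add: algebra_simps)
    have "complex_cyclotomic n - ?h u = 0"
    proof (rule ccontr)
      assume nz: "complex_cyclotomic n - ?h u \<noteq> 0"
      have hP0: "?h P \<noteq> 0" using \<open>lead_coeff (?h P) = 1\<close> by auto
      have "degree (?h r) = degree P + degree (complex_cyclotomic n - ?h u)"
        using * degree_mult_eq[OF hP0 nz] deg by simp
      moreover have "?h r \<noteq> 0" using * hP0 nz by (metis mult_eq_0_iff)
      ultimately show False using r deg[of r] by auto
    qed
    then show ?thesis by (intro exI[of _ u]) simp
  qed
qed

lemma of_int_cyclotomic: "map_poly of_int (cyclotomic n) = complex_cyclotomic n"
proof -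
  obtain p where p: "map_poly of_int p = complex_cyclotomic n"
    using complex_cyclotomic_integral by blast
  have "p' = p" if "map_poly of_int p' = complex_cyclotomic n" for p'
  proof (rule poly_eqI)
    fix i
    have "coeff (map_poly (of_int :: int \<Rightarrow> complex) p') i = coeff (map_poly of_int p) i"
      using p that by simp
    then show "coeff p' i = coeff p i" by (simp add: coeff_map_poly)
  qed
  then show ?thesis
    unfolding cyclotomic_def
    by (rule theI[where P = "\<lambda>p. map_poly of_int p = complex_cyclotomic n", OF p])
qed

definition ratfun_cong :: "'a::field poly fract \<Rightarrow> 'a poly fract \<Rightarrow> 'a poly \<Rightarrow> bool" where
  "ratfun_cong A B P \<longleftrightarrow>
     (\<exists>f g. g \<noteq> 0 \<and> A - B = Fraction_Field.Fract f g \<and> P dvd f \<and> coprime g P)"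

text \<open>
  The ambient field is \<open>\<rat>(x)(q)\<close>, rational functions in \<open>q\<close> whose coefficients are
  rational functions in \<open>x\<close>.
\<close>

type_synonym ratfun_xq = "rat poly fract poly fract"

definition indet_q :: ratfun_xq where
  "indet_q = to_fract [:0, 1:]"

definition indet_x :: ratfun_xq where
  "indet_x = to_fract [:to_fract [:0, 1:]:]"

end

theory Submission
  imports Defs
begin

text \<open>
  Write \<open>n = s + e N\<close> with \<open>e = d\<close>, \<open>N = 2m\<close> on the left and \<open>e = 2d\<close>, \<open>N = m\<close> on the right, and
  put \<open>p = q\<^sup>e\<close>. Since \<open>q\<^sup>n \<equiv> 1\<close> modulo \<open>\<Phi>\<^sub>n\<close>, the parameter \<open>q\<^sup>s\<close> may be replaced by
  \<open>p\<close> to the power \<open>-N\<close>; the denominators are harmless because \<open>e\<close> is coprime to \<open>n\<close>. The case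
  \<open>c = 0\<close> of the \<open>q\<close>-Chu--Vandermonde formula evaluates the resulting terminating sum as the
  \<open>N\<close>-th power of its first parameter. So both sides are congruent to \<open>x\<close> to the power \<open>2m\<close>.
\<close>

section \<open>The terminating sum\<close>

lemma qpoch_0 [simp]: "qpoch a q 0 = 1"
  by (simp add: qpoch_def)

lemma qpoch_Suc [simp]: "qpoch a q (Suc k) = qpoch a q k * (1 - a * q ^ k)"
  by (simp add: qpoch_def)

lemma qpoch_div_Suc:
  fixes y p :: "'a::field"
  assumes "p \<noteq> 0"
  shows "qpoch (y / p) p (Suc k) = (1 - y / p) * qpoch y p k"
  using assms by (induction k) simp_all

text \<open>A partial sum of the basic hypergeometric series 2phi1 with base and argument
  \<open>p\<close> and lower parameter 0. The cutoff \<open>M\<close> is independent of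
  \<open>y\<close>, since the parameter \<open>q^s\<close> does not terminate the series.\<close>

definition qsum :: "'a::field \<Rightarrow> 'a \<Rightarrow> 'a \<Rightarrow> nat \<Rightarrow> 'a" where
  "qsum x y p M = (\<Sum>k\<le>M. qpoch x p k * qpoch y p k / qpoch p p k * p ^ k)"

text \<open>Contiguous relation behind the evaluation: dividing \<open>y\<close> by \<open>p\<close>
  costs a factor \<open>x\<close>. The boundary term makes it exact for every cutoff, so that
  induction on \<open>M\<close> applies; it vanishes once \<open>qpoch y p M\<close> does.\<close>

lemma qsum_times_first_parameter:
  fixes x y p :: "'a::field"
  assumes p0: "p \<noteq> 0" and p1: "\<And>j. j > 0 \<Longrightarrow> p ^ j \<noteq> 1"
  shows "x * qsum x y p M =
    qsum x (y / p) p M - qpoch y p M / qpoch p p M * qpoch x p (Suc M)"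
proof (induction M)
  case 0
  then show ?case by (simp add: qsum_def)
next
  case (Suc M)
  define E where "E = qpoch y p M / qpoch p p M"
  define X where "X = qpoch x p (Suc M)"
  define r where "r = p ^ M"
  have r: "r * p \<noteq> 1" using p1[of "Suc M"] by (simp add: r_def mult.commute)
  have e1: "qpoch y p (Suc M) / qpoch p p (Suc M) = E * ((1 - y * r) / (1 - p * r))"
    by (simp add: E_def r_def)
  have e2: "qpoch (y / p) p (Suc M) / qpoch p p (Suc M) = E * ((1 - y / p) / (1 - p * r))"
    unfolding qpoch_div_Suc[OF p0] by (simp add: E_def r_def)
  have X2: "qpoch x p (Suc (Suc M)) = X * (1 - x * (r * p))"
    unfolding X_def by (simp add: r_def mult_ac)
  have s: "qsum x z p (Suc M) =
      qsum x z p M + X * (qpoch z p (Suc M) / qpoch p p (Suc M)) * (r * p)" for z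
    by (simp add: qsum_def X_def r_def mult_ac)
  have IH: "x * qsum x y p M = qsum x (y / p) p M - E * X"
    using Suc by (simp add: E_def X_def)
  \<comment> \<open>The factor \<open>r * p\<close> of the new summand turns the
    \<open>y / p\<close> ratio into the \<open>y\<close> ratio minus 1; the rest is an identity in
    an arbitrary value \<open>c\<close> of the latter.\<close>
  have k: "(r * p) * ((1 - y / p) / (1 - p * r)) = (1 - y * r) / (1 - p * r) - 1"
    using p0 r by (simp add: field_simps)
  have "x * (X * (E * c) * (r * p)) = X * E * (c - 1) - E * c * (X * (1 - x * (r * p))) + E * X" for c
    by (simp add: algebra_simps)
  from this[of "(1 - y * r) / (1 - p * r)", folded k]
  have "x * (X * (E * ((1 - y * r) / (1 - p * r))) * (r * p)) =
      X * (E * ((1 - y / p) / (1 - p * r))) * (r * p)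
      - E * ((1 - y * r) / (1 - p * r)) * (X * (1 - x * (r * p))) + E * X"
    by (simp only: mult_ac)
  then show ?case
    unfolding s e1 e2 X2 distrib_left IH by simp
qed

text \<open>The factor with index \<open>N\<close> is
  \<open>1 - inverse p ^ N * p ^ N\<close>.\<close>

lemma qpoch_inverse_power_eq_0:
  fixes p :: "'a::field"
  assumes "p \<noteq> 0" "N < k"
  shows "qpoch (inverse p ^ N) p k = 0"
  unfolding qpoch_def using assms by (intro prod_zero) (auto simp: field_simps intro!: bexI[of _ N])

text \<open>Starting from \<open>y = 1\<close>, where only \<open>k = 0\<close> survives, each
  division of \<open>y\<close> by \<open>p\<close> contributes one \<open>x\<close>. The boundary
  term vanishes in each step because \<open>N < M\<close> there.\<close>

lemma qsum_inverse_power: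
  fixes x p :: "'a::field"
  assumes p0: "p \<noteq> 0" and p1: "\<And>j. j > 0 \<Longrightarrow> p ^ j \<noteq> 1" and "N \<le> M"
  shows "qsum x (inverse p ^ N) p M = x ^ N"
  using \<open>N \<le> M\<close>
proof (induction N)
  case 0
  have "qsum x 1 p M = (\<Sum>k\<le>M. if k = 0 then 1 else 0)"
    unfolding qsum_def
    using qpoch_inverse_power_eq_0[OF p0, of 0] by (intro sum.cong) auto
  then show ?case by simp
next
  case (Suc N)
  have "x * qsum x (inverse p ^ N) p M = qsum x (inverse p ^ N / p) p M"
    using qsum_times_first_parameter[OF p0 p1, of x "inverse p ^ N" M]
      qpoch_inverse_power_eq_0[OF p0, of N M] Suc.prems by simp
  then show ?case using Suc by (simp add: divide_inverse mult.commute)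
qed

section \<open>Localization of a polynomial ring\<close>

text \<open>
  Bezout's identity is used in place of \<^const>\<open>coprime\<close>, because polynomials over an arbitrary field
  are not an instance of the gcd type classes.
\<close>

definition comaximal :: "'a::comm_ring_1 \<Rightarrow> 'a \<Rightarrow> bool" where
  "comaximal a b \<longleftrightarrow> (\<exists>u v. u * a + v * b = 1)"

lemma comaximal_1: "comaximal 1 b"
  unfolding comaximal_def by (intro exI[of _ 1] exI[of _ 0]) simp

lemma comaximal_mult:
  assumes "comaximal a c" "comaximal b c"
  shows "comaximal (a * b) c"
proof -
  obtain u v w z where uv: "u * a + v * c = 1" and wz: "w * b + z * c = 1"
    using assms unfolding comaximal_def by blast
  have "(u * w) * (a * b) + (v * w * b + z) * c = (u * a + v * c) * (w * b) + z * c"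
    by (simp add: algebra_simps)
  also have "\<dots> = 1" by (simp add: uv wz)
  finally show ?thesis unfolding comaximal_def by blast
qed

lemma comaximal_imp_coprime:
  assumes "comaximal a b"
  shows "coprime a b"
proof (rule coprimeI)
  fix c assume "c dvd a" "c dvd b"
  moreover obtain u v where "u * a + v * b = 1"
    using assms unfolding comaximal_def by blast
  ultimately show "is_unit c" by (metis dvd_add dvd_mult)
qed

text \<open>Fractions with denominators invertible modulo \<open>P\<close>. Congruences are confined
  to multipliers from this ring because in the full fraction field everything is a multiple of a
  nonzero \<open>P\<close>.\<close>

definition localization :: "'a::idom \<Rightarrow> 'a fract set" where
  "localization P = {to_fract f / to_fract g | f g. g \<noteq> 0 \<and> comaximal g P}"

lemma localizationI:
  "g \<noteq> 0 \<Longrightarrow> comaximal g P \<Longrightarrow> to_fract f / to_fract g \<in> localization P"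
  unfolding localization_def by blast

lemma localizationE:
  assumes "a \<in> localization P"
  obtains f g where "g \<noteq> 0" "comaximal g P" "a = to_fract f / to_fract g"
  using assms unfolding localization_def by blast

lemma to_fract_in_localization: "to_fract f \<in> localization P"
  using localizationI[OF _ comaximal_1, of f P] by simp

lemma inverse_in_localization:
  "g \<noteq> 0 \<Longrightarrow> comaximal g P \<Longrightarrow> inverse (to_fract g) \<in> localization P"
  using localizationI[of g P 1] by (simp add: divide_inverse)

lemma localization_mult:
  assumes "a \<in> localization P" "b \<in> localization P"
  shows "a * b \<in> localization P"
proof -
  obtain f g f' g' where "g \<noteq> 0" "comaximal g P" "a = to_fract f / to_fract g"
    "g' \<noteq> 0" "comaximal g' P" "b = to_fract f' / to_fract g'"
    using assms by (metis localizationE)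
  then show ?thesis
    using localizationI[of "g * g'" P "f * f'"] by (simp add: comaximal_mult)
qed

lemma localization_add:
  assumes "a \<in> localization P" "b \<in> localization P"
  shows "a + b \<in> localization P"
proof -
  obtain f g f' g' where "g \<noteq> 0" "comaximal g P" "a = to_fract f / to_fract g"
    "g' \<noteq> 0" "comaximal g' P" "b = to_fract f' / to_fract g'"
    using assms by (metis localizationE)
  then show ?thesis
    using localizationI[of "g * g'" P "f * g' + f' * g"]
    by (simp add: comaximal_mult add_frac_eq)
qed

lemma localization_0: "0 \<in> localization P"
  using to_fract_in_localization[of 0] by simp

lemma localization_1: "1 \<in> localization P"
  using to_fract_in_localization[of 1] by simp

lemma localization_diff:
  assumes "a \<in> localization P" "b \<in> localization P"
  shows "a - b \<in> localization P"
  using localization_add[OF assms(1) localization_mult[OF to_fract_in_localization[of "-1"] assms(2)]]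
  by simp

lemma localization_power: "a \<in> localization P \<Longrightarrow> a ^ k \<in> localization P"
  by (induction k) (simp_all add: localization_1 localization_mult)

lemma localization_qpoch:
  "a \<in> localization P \<Longrightarrow> q \<in> localization P \<Longrightarrow> qpoch a q k \<in> localization P"
  by (induction k)
    (simp_all add: localization_1 localization_mult localization_diff localization_power)

section \<open>Congruence modulo \<open>P\<close> in the localization\<close>

definition local_cong :: "'a::idom \<Rightarrow> 'a fract \<Rightarrow> 'a fract \<Rightarrow> bool" where
  "local_cong P a b \<longleftrightarrow> (\<exists>r\<in>localization P. a - b = to_fract P * r)"

lemma local_cong_refl: "local_cong P a a"
  unfolding local_cong_def using localization_0 by force

lemma local_cong_add:
  assumes "local_cong P a b" "local_cong P c d"
  shows "local_cong P (a + c) (b + d)"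
proof -
  obtain r t where "r \<in> localization P" "a - b = to_fract P * r"
    "t \<in> localization P" "c - d = to_fract P * t"
    using assms unfolding local_cong_def by blast
  then show ?thesis unfolding local_cong_def
    by (intro bexI[of _ "r + t"]) (simp_all add: localization_add algebra_simps)
qed

lemma local_cong_sum:
  "(\<And>i. i \<in> A \<Longrightarrow> local_cong P (f i) (g i)) \<Longrightarrow> local_cong P (sum f A) (sum g A)"
  by (induction A rule: infinite_finite_induct) (simp_all add: local_cong_refl local_cong_add)

text \<open>Membership is asked of \<open>a\<close> and \<open>d\<close> because these are the
  cofactors in \<open>a * (c - d) + (a - b) * d\<close>.\<close>

lemma local_cong_mult:
  assumes "local_cong P a b" "local_cong P c d" "a \<in> localization P" "d \<in> localization P"
  shows "local_cong P (a * c) (b * d)"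
proof -
  obtain r t where rt: "r \<in> localization P" "a - b = to_fract P * r"
    "t \<in> localization P" "c - d = to_fract P * t"
    using assms unfolding local_cong_def by blast
  have "a * c - b * d = a * (c - d) + (a - b) * d" by (simp add: algebra_simps)
  also have "\<dots> = to_fract P * (a * t + r * d)" unfolding rt by (simp add: algebra_simps)
  finally show ?thesis unfolding local_cong_def
    using assms(3,4) rt by (intro bexI[of _ "a * t + r * d"] localization_add localization_mult)
qed

lemma local_cong_qpoch:
  assumes "local_cong P a b" "a \<in> localization P" "b \<in> localization P" "q \<in> localization P"
  shows "local_cong P (qpoch a q k) (qpoch b q k)"
proof (induction k)
  case 0
  then show ?case by (simp add: local_cong_refl)
next
  case (Suc k)
  have "local_cong P (1 - a * q ^ k) (1 - b * q ^ k)"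
  proof -
    obtain r where r: "r \<in> localization P" "a - b = to_fract P * r"
      using assms unfolding local_cong_def by blast
    have "(1 - a * q ^ k) - (1 - b * q ^ k) = (a - b) * (to_fract (-1) * q ^ k)"
      by (simp add: algebra_simps)
    also have "\<dots> = to_fract P * (r * (to_fract (-1) * q ^ k))"
      unfolding r by (simp add: algebra_simps)
    finally show ?thesis unfolding local_cong_def using r assms
      by (intro bexI[of _ "r * (to_fract (-1) * q ^ k)"] localization_mult
          to_fract_in_localization localization_power)
  qed
  then show ?case unfolding qpoch_Suc using Suc assms
    by (intro local_cong_mult localization_qpoch localization_diff localization_mult
        localization_1 localization_power)
qed

lemma local_cong_sym_trans:
  assumes "local_cong P a c" "local_cong P b c"
  shows "local_cong P a b"
proof -
  obtain r t where "r \<in> localization P" "a - c = to_fract P * r"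
    "t \<in> localization P" "b - c = to_fract P * t"
    using assms unfolding local_cong_def by blast
  then show ?thesis unfolding local_cong_def
    by (intro bexI[of _ "r - t"]) (simp_all add: localization_diff algebra_simps)
qed

lemma local_cong_imp_ratfun_cong:
  assumes "local_cong P a b"
  shows "ratfun_cong a b P"
proof -
  obtain f g where "g \<noteq> 0" "comaximal g P" "a - b = to_fract P * (to_fract f / to_fract g)"
    using assms unfolding local_cong_def by (metis localizationE)
  then show ?thesis unfolding ratfun_cong_def
    by (intro exI[of _ "P * f"] exI[of _ g])
      (simp add: Fract_conv_to_fract comaximal_imp_coprime)
qed

section \<open>Cyclotomic polynomials over a field of characteristic zero\<close>

text \<open>Descends from the complex factorization coefficientwise, by injectivity of
  \<open>of_int\<close>.\<close>

lemma prod_cyclotomic: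
  assumes "n > 0"
  shows "(\<Prod>d\<in>{d. d dvd n}. cyclotomic d) = monom 1 n - 1"
proof -
  have "map_poly (of_int :: int \<Rightarrow> complex) (\<Prod>d\<in>{d. d dvd n}. cyclotomic d) = monom 1 n - 1"
    unfolding map_poly_of_int_prod of_int_cyclotomic by (rule prod_complex_cyclotomic[OF assms])
  also have "\<dots> = map_poly of_int (monom 1 n - 1)"
    by (intro poly_eqI) (auto simp: coeff_map_poly)
  finally have "coeff (map_poly (of_int :: int \<Rightarrow> complex) (\<Prod>d\<in>{d. d dvd n}. cyclotomic d)) i =
      coeff (map_poly of_int (monom 1 n - 1)) i" for i
    by simp
  then show ?thesis
    unfolding poly_eq_iff coeff_map_poly[of of_int, OF of_int_0] of_int_eq_iff by blast
qed

text \<open>The cyclotomic factors of \<open>q^g - 1\<close> are indexed by divisors of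
  \<open>g\<close>, hence of \<open>n\<close>, and \<open>n\<close> is not among them. The
  factorization is made over the integers and then mapped to the ring.\<close>

lemma cyclotomic_mult_dvd:
  assumes "n > 0" "g dvd n" "g < n"
  shows "map_poly of_int (cyclotomic n) * (monom 1 g - 1) dvd (monom 1 n - 1 :: 'a::comm_ring_1 poly)"
proof -
  have "g > 0" using assms by (auto intro: Nat.gr0I)
  have fin: "finite {d. d dvd n}" using assms by simp
  have "cyclotomic n * (monom 1 g - 1) = (\<Prod>d\<in>insert n {d. d dvd g}. cyclotomic d)"
    using assms \<open>g > 0\<close> by (subst prod.insert) (auto simp: prod_cyclotomic dest: dvd_imp_le)
  also have "\<dots> dvd (\<Prod>d\<in>{d. d dvd n}. cyclotomic d)"
    using fin assms by (intro prod_dvd_prod_subset) (auto intro: dvd_trans)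
  finally obtain R where R: "monom 1 n - 1 = cyclotomic n * (monom 1 g - 1) * R"
    using prod_cyclotomic[OF \<open>n > 0\<close>] by (metis dvdE)
  let ?h = "map_poly (of_int :: int \<Rightarrow> 'a)"
  have mult: "?h (p * r) = ?h p * ?h r" for p r
    by (intro poly_eqI) (simp add: coeff_map_poly coeff_mult)
  have mon: "?h (monom 1 k - 1) = monom 1 k - 1" for k
    by (intro poly_eqI) (auto simp: coeff_map_poly)
  show ?thesis using arg_cong[OF R, of ?h] unfolding mult mon by (rule dvdI)
qed

lemma cyclotomic_dvd:
  assumes "n > 0"
  shows "map_poly of_int (cyclotomic n) dvd (monom 1 n - 1 :: 'a::comm_ring_1 poly)"
\<comment> \<open>For \<open>n = 1\<close> there is no proper divisor to use; otherwise 1 is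
  one.\<close>
proof (cases "n = 1")
  case True
  have "{d::nat. d dvd 1} = {1}" by auto
  then have "cyclotomic 1 = monom 1 1 - 1" using prod_cyclotomic[of 1] by simp
  moreover have "map_poly (of_int :: int \<Rightarrow> 'a) (monom 1 1 - 1) = monom 1 1 - 1"
    by (intro poly_eqI) (auto simp: coeff_map_poly)
  ultimately show ?thesis using True by simp
next
  case False
  then show ?thesis using cyclotomic_mult_dvd[of n 1, where 'a = 'a] assms
    by (auto intro: dvd_mult_left)
qed

text \<open>With \<open>q\<^sup>n - 1 = A B R\<close>, \<open>A = \<Phi>\<^sub>n\<close>, \<open>B = q\<^sup>g - 1\<close>, the identity
  \<open>q (q\<^sup>n - 1)' - n (q\<^sup>n - 1) = n\<close> and the product rule put the unit \<open>n\<close> into the ideal \<open>(A, B)\<close>.\<close>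

lemma comaximal_cyclotomic_divisor:
  assumes "n > 0" "g dvd n" "g < n"
  shows "comaximal (monom 1 g - 1 :: 'a::field_char_0 poly) (map_poly of_int (cyclotomic n))"
proof -
  define A :: "'a poly" where "A = map_poly of_int (cyclotomic n)"
  define B :: "'a poly" where "B = monom 1 g - 1"
  define F :: "'a poly" where "F = monom 1 n - 1"
  obtain R where R: "F = A * B * R"
    using cyclotomic_mult_dvd[OF assms, where 'a = 'a] unfolding A_def B_def F_def by (rule dvdE)
  have "monom 1 1 * pderiv F - of_nat n * F = of_nat n"
    using \<open>n > 0\<close>
    by (simp add: F_def pderiv_diff pderiv_monom mult_monom of_nat_poly algebra_simps smult_monom)
  moreover have "pderiv F = pderiv A * B * R + A * (pderiv B * R + B * pderiv R)"
    unfolding R by (simp add: pderiv_mult algebra_simps)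
  ultimately have eq: "monom 1 1 * pderiv A * R * B +
      (monom 1 1 * (pderiv B * R + B * pderiv R) - of_nat n * B * R) * A = of_nat n"
    unfolding R by (simp add: algebra_simps)
  define c :: "'a poly" where "c = [:inverse (of_nat n):]"
  have "c * of_nat n = 1"
    using \<open>n > 0\<close> by (simp add: c_def of_nat_poly one_pCons)
  then have "(c * (monom 1 1 * pderiv A * R)) * B +
      (c * (monom 1 1 * (pderiv B * R + B * pderiv R) - of_nat n * B * R)) * A = 1"
    using arg_cong[OF eq, of "\<lambda>z. c * z"] by (simp add: distrib_left mult.assoc)
  then show ?thesis unfolding comaximal_def A_def B_def by blast
qed

lemma power_minus_1_dvd:
  fixes a :: "'a::comm_ring_1"
  shows "a ^ j - 1 dvd a ^ (j * k) - 1"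
  by (metis power_mult power_diff_1_eq dvd_triv_left)

text \<open>Reduces to the proper divisor \<open>g = gcd j n\<close>: by Bezout,
  \<open>q^g - 1\<close> lies in the ideal generated by \<open>q^j - 1\<close> and the cyclotomic
  polynomial.\<close>

lemma comaximal_cyclotomic:
  assumes "n > 0" "\<not> n dvd j"
  shows "comaximal (1 - monom 1 j :: 'a::field_char_0 poly) (map_poly of_int (cyclotomic n))"
proof -
  define A :: "'a poly" where "A = map_poly of_int (cyclotomic n)"
  define q :: "'a poly" where "q = monom 1 1"
  have q: "monom 1 k = q ^ k" for k by (simp add: q_def monom_power)
  define g where "g = gcd j n"
  have "j \<noteq> 0" using assms by (auto intro: Nat.gr0I)
  have g: "g dvd n" "g < n"
    using assms by (auto simp: g_def order_le_less dest: dvd_imp_le)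
      (metis gcd_dvd1 gcd_dvd2 dvd_imp_le le_neq_implies_less)
  \<comment> \<open>This form of Bezout keeps all exponents natural.\<close>
  obtain a b where ab: "j * a = n * b + g"
    using bezout_nat[OF \<open>j \<noteq> 0\<close>, of n] by (auto simp: g_def)
  obtain u where u: "q ^ (j * a) - 1 = (q ^ j - 1) * u"
    using power_minus_1_dvd by (rule dvdE)
  have "A dvd q ^ (n * b) - 1"
    using cyclotomic_dvd[OF \<open>n > 0\<close>, where 'a = 'a] power_minus_1_dvd[of q n b]
    by (metis A_def q dvd_trans)
  then obtain v where v: "q ^ (n * b) - 1 = A * v" by (rule dvdE)
  \<comment> \<open>From \<open>q^(j a) - 1 = q^g (q^(n b) - 1) + (q^g - 1)\<close>.\<close>
  have qg: "q ^ g - 1 = (q ^ j - 1) * u - q ^ g * (A * v)"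
    unfolding u[symmetric] v[symmetric] ab by (simp add: algebra_simps power_add)
  obtain w z where "w * (q ^ g - 1) + z * A = 1"
    using comaximal_cyclotomic_divisor[OF \<open>n > 0\<close> g, where 'a = 'a]
    unfolding comaximal_def A_def q by blast
  then have "(- (w * u)) * (1 - q ^ j) + (z - w * q ^ g * v) * A = 1"
    unfolding qg by (simp add: algebra_simps)
  then show ?thesis unfolding comaximal_def A_def q by blast
qed

section \<open>The congruence\<close>

lemma indet_q_power: "indet_q ^ k = to_fract (monom 1 k)"
proof (induction k)
  case (Suc k)
  have "(monom 1 (Suc k) :: rat poly fract poly) = [:0, 1:] * monom 1 k"
    by (simp add: monom_Suc)
  then have "to_fract (monom 1 (Suc k)) = indet_q * to_fract (monom 1 k)"
    unfolding indet_q_def by (simp only: to_fract_mult)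
  then show ?case using Suc by simp
qed (simp flip: one_pCons add: monom_0)

lemma indet_q_nonzero: "indet_q \<noteq> 0"
  by (simp add: indet_q_def)

lemma indet_q_power_neq_1:
  assumes "k > 0"
  shows "indet_q ^ k \<noteq> 1"
proof
  assume "indet_q ^ k = 1"
  then have "(monom 1 k :: rat poly fract poly) = 1"
    unfolding indet_q_power by (metis to_fract_1 to_fract_eq_iff)
  then have "degree (monom 1 k :: rat poly fract poly) = 0" by simp
  then show False using assms by (simp add: degree_monom_eq)
qed

text \<open>The factors are \<open>1 - q^(e i)\<close> with \<open>1 \<le> i \<le> k < n\<close>,
  and \<open>n\<close>, being coprime to \<open>e\<close>, divides no such
  \<open>e i\<close>.\<close>

lemma inverse_qpoch_in_localization:
  assumes "n > 0" "coprime e n" "e > 0" "k < n"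
  shows "inverse (qpoch (indet_q ^ e) (indet_q ^ e) k) \<in>
    localization (map_poly of_int (cyclotomic n))"
  using \<open>k < n\<close>
proof (induction k)
  case 0
  then show ?case by (simp add: localization_1)
next
  case (Suc k)
  have eq: "1 - indet_q ^ e * (indet_q ^ e) ^ k = to_fract (1 - monom 1 (e * Suc k))"
    unfolding to_fract_diff indet_q_power[symmetric] by (simp add: power_add power_mult)
  have "\<not> n dvd e * Suc k"
    using assms(2) Suc.prems
    by (metis coprime_commute coprime_dvd_mult_right_iff dvd_imp_le not_le zero_less_Suc)
  then have "comaximal (1 - monom 1 (e * Suc k) :: rat poly fract poly)
      (map_poly of_int (cyclotomic n))"
    by (rule comaximal_cyclotomic[OF \<open>n > 0\<close>])
  moreover have "(1 - monom 1 (e * Suc k) :: rat poly fract poly) \<noteq> 0"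
  proof -
    have "e * Suc k > 0" using \<open>e > 0\<close> by simp
    from indet_q_power_neq_1[OF this] show ?thesis
      unfolding indet_q_power by (metis eq_iff_diff_eq_0 to_fract_1)
  qed
  ultimately show ?case
    using Suc unfolding qpoch_Suc inverse_mult_distrib eq
    by (intro localization_mult inverse_in_localization) auto
qed

text \<open>General in \<open>X\<close>, \<open>e\<close> and \<open>N\<close> so that both sides of
  the theorem are instances.\<close>

lemma qsum_local_cong:
  fixes X :: ratfun_xq and e n N :: nat and s :: int
  defines "P \<equiv> map_poly of_int (cyclotomic n)"
  assumes "n > 0" "coprime e n" "e > 0" "N < n" and s: "int n = s + int (e * N)"
    and X: "X \<in> localization P"
  shows "local_cong P (qsum X (indet_q powi s) (indet_q ^ e) (n - 1)) (X ^ N)"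
proof -
  let ?q = indet_q and ?p = "indet_q ^ e"
  let ?y = "inverse ?p ^ N"
  have P: "P dvd monom 1 n - 1" unfolding P_def by (rule cyclotomic_dvd[OF \<open>n > 0\<close>])
  then obtain R where R: "monom 1 n - 1 = P * R" by (rule dvdE)
  have qL: "?q \<in> localization P" unfolding indet_q_def by (rule to_fract_in_localization)
  \<comment> \<open>\<open>q\<close> is invertible modulo \<open>P\<close> with inverse
    \<open>q^(n-1)\<close>, so negative powers of \<open>q\<close> stay in the localization.\<close>
  have "comaximal [:0, 1:] P"
  proof -
    have "monom 1 n = (monom 1 (n - 1) * [:0, 1:] :: rat poly fract poly)"
      using \<open>n > 0\<close> by (cases n) (simp_all add: monom_Suc)
    then have "monom 1 (n - 1) * [:0, 1:] + (- R) * P = 1"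
      using R by (simp add: algebra_simps)
    then show ?thesis unfolding comaximal_def by blast
  qed
  then have iqL: "inverse ?q \<in> localization P"
    unfolding indet_q_def by (intro inverse_in_localization) auto
  have ipL: "inverse ?p \<in> localization P"
    using localization_power[OF iqL, of e] by (simp add: power_inverse)
  then have yL: "?y \<in> localization P" by (rule localization_power)
  \<comment> \<open>Since \<open>s = n - e N\<close>, the two parameters differ exactly by the
    factor \<open>q^n\<close>.\<close>
  have qs: "?q powi s = ?y * ?q ^ n"
  proof -
    have "?q powi s = ?q powi (int n - int (e * N))" using s by simp
    also have "\<dots> = ?q ^ n / ?q ^ (e * N)"
      using indet_q_nonzero by (simp add: power_int_diff power_int_of_nat del: of_nat_mult)
    also have "\<dots> = ?q ^ n / ?p ^ N" by (simp only: power_mult)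
    finally show ?thesis by (simp add: power_inverse divide_inverse mult.commute)
  qed
  have qsL: "?q powi s \<in> localization P"
    unfolding qs by (intro localization_mult[OF yL] localization_power qL)
  have "?q powi s - ?y = ?y * to_fract (monom 1 n - 1)"
    unfolding qs indet_q_power by (simp add: algebra_simps)
  also have "\<dots> = to_fract P * (?y * to_fract R)"
    unfolding R by (simp add: mult_ac)
  finally have cong: "local_cong P (?q powi s) ?y"
    unfolding local_cong_def using yL
    by (intro bexI[of _ "?y * to_fract R"] localization_mult to_fract_in_localization)
  have "local_cong P (qsum X (?q powi s) ?p (n - 1)) (qsum X ?y ?p (n - 1))"
    unfolding qsum_def
  proof (rule local_cong_sum)
    fix k assume "k \<in> {..n - 1}"
    then have "inverse (qpoch ?p ?p k) \<in> localization P"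
      unfolding P_def using assms by (intro inverse_qpoch_in_localization) auto
    then show "local_cong P (qpoch X ?p k * qpoch (?q powi s) ?p k / qpoch ?p ?p k * ?p ^ k)
        (qpoch X ?p k * qpoch ?y ?p k / qpoch ?p ?p k * ?p ^ k)"
      unfolding divide_inverse using X qL ipL qsL cong
      by (intro local_cong_mult local_cong_refl local_cong_qpoch localization_mult
          localization_qpoch localization_power)
  qed
  \<comment> \<open>\<open>N < n\<close> puts the termination index within the cutoff
    \<open>n - 1\<close>.\<close>
  moreover have "qsum X ?y ?p (n - 1) = X ^ N"
    using \<open>N < n\<close> \<open>e > 0\<close> indet_q_nonzero indet_q_power_neq_1[of "e * _"]
    by (intro qsum_inverse_power) (auto simp: power_mult)
  ultimately show ?thesis by simp
qed

theorem theorem1p3: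
  fixes d n :: nat and s :: int
  assumes "d \<ge> 2" and "n > 0" and "s \<in> {-1, 1}" and "[int n = s] (mod (2 * int d))"
  shows "ratfun_cong
    (\<Sum>k=0..n-1. qpoch indet_x (indet_q ^ d) k * qpoch (indet_q powi s) (indet_q ^ d) k
        / qpoch (indet_q ^ d) (indet_q ^ d) k * indet_q ^ (d * k))
    (\<Sum>k=0..n-1. qpoch (indet_x ^ 2) (indet_q ^ (2 * d)) k * qpoch (indet_q powi s) (indet_q ^ (2 * d)) k
        / qpoch (indet_q ^ (2 * d)) (indet_q ^ (2 * d)) k * indet_q ^ (2 * d * k))
    (map_poly of_int (cyclotomic n))"
proof -
  let ?P = "map_poly of_int (cyclotomic n)"
  obtain t where t: "int n - s = 2 * int d * t"
    using assms(4) unfolding cong_iff_dvd_diff by (rule dvdE)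
  \<comment> \<open>Holds because \<open>s \<le> 1 \<le> n\<close>.\<close>
  have "t \<ge> 0"
  proof (rule ccontr)
    assume "\<not> t \<ge> 0"
    then have "2 * int d * t < 0" using assms(1) by (simp add: mult_pos_neg)
    then have "int n - s < 0" using t by simp
    then show False using assms(2,3) by auto
  qed
  then obtain m where m: "t = int m" using nonneg_int_cases by blast
  have n: "int n = s + int (2 * d * m)" using t m by simp
  \<comment> \<open>A common divisor of \<open>2 d\<close> and \<open>n\<close> divides
    \<open>s\<close>, a unit.\<close>
  have "coprime (int (2 * d)) (int n)"
  proof (rule coprimeI)
    fix c assume c: "c dvd int (2 * d)" "c dvd int n"
    then have "c dvd int n - int (2 * d * m)" by (intro dvd_diff) auto
    then show "is_unit c" using n assms(3) by auto
  qed
  then have cop: "coprime (2 * d) n" by (simp only: coprime_int_iff)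
  \<comment> \<open>Here \<open>d \<ge> 2\<close> enters: \<open>n \<ge> 4 m - 1 > 2 m\<close> for
    positive \<open>m\<close>.\<close>
  have "2 * m < n"
  proof (cases "m = 0")
    case False
    have "2 * (2 * m) \<le> d * (2 * m)" using assms(1) by (intro mult_right_mono) auto
    moreover have "int n - s = int (d * (2 * m))" using n by simp
    ultimately have "int (4 * m) \<le> int n - s" by linarith
    then show ?thesis using False assms(3) by auto
  qed (use assms in simp)
  have x: "indet_x \<in> localization ?P"
    unfolding indet_x_def by (rule to_fract_in_localization)
  \<comment> \<open>The instances are \<open>e = d\<close>, \<open>N = 2 m\<close> and then
    \<open>e = 2 d\<close>, \<open>N = m\<close>; the values agree as
    \<open>(x^2)^m = x^(2 m)\<close>.\<close>
  have "local_cong ?P (qsum indet_x (indet_q powi s) (indet_q ^ d) (n - 1)) (indet_x ^ (2 * m))"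
    using assms cop n x \<open>2 * m < n\<close> by (intro qsum_local_cong) (auto simp: mult_ac)
  moreover have "local_cong ?P
      (qsum (indet_x ^ 2) (indet_q powi s) (indet_q ^ (2 * d)) (n - 1)) ((indet_x ^ 2) ^ m)"
    using assms cop n x \<open>2 * m < n\<close>
    by (intro qsum_local_cong localization_power) (auto simp: mult_ac)
  ultimately have "local_cong ?P (qsum indet_x (indet_q powi s) (indet_q ^ d) (n - 1))
      (qsum (indet_x ^ 2) (indet_q powi s) (indet_q ^ (2 * d)) (n - 1))"
    unfolding power_mult[symmetric] by (rule local_cong_sym_trans)
  then show ?thesis
    unfolding qsum_def atLeast0AtMost power_mult[of indet_q "2 * d"] power_mult[of indet_q d]
    by (intro local_cong_imp_ratfun_cong) (simp add: power_mult)
qed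

end
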